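(* Let $M\ge2$ be even, $N\ge1$, and let $\mathbf{V}\in\mathbb{C}^{N\times N}$ be full-rank (i.e., $D=N$). Then the cardinality of the candidate set equals the number of elements of $\mathcal{A}_M^{N-1}$, i.e., $$|\mathcal{S}(\mathbf{V})|=\sum_{d=1}^{N}\sum_{i=0}^{d-1}\binom{N}{i}\binom{N-i}{2(d-i)-1}\Big(\frac{M}{2}\Big)^{2(d-i)-2}\Big(\frac{M}{2}-1\Big)^{i}=M^{N-1}=|\mathcal{A}_M^{N-1}|,$$ and a maximizer $\mathbf{s}_{\rm opt}$ of $\|\mathbf{V}^{\mathcal{H}}\mathbf{s}\|$ over $\mathbf{s}\in\mathcal{A}_M^N$ can be found by exhaustive search over $\mathcal{A}_M^{N-1}$, i.e., $$\max_{\mathbf{s}\in\mathcal{A}_M^N}\|\mathbf{V}^{\mathcal{H}}\mathbf{s}\|=\max_{\mathbf{t}\in\mathcal{A}_M^{N-1}}\left\|\mathbf{V}^{\mathcal{H}}\begin{bmatrix}1\\ \mathbf{t}\end{bmatrix}\right\|.$$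
   Context: $\mathcal{A}_M=\{e^{j2\pi m/M}: m=0,\ldots,M-1\}$; $\cdot^{\mathcal{H}}$ is the conjugate transpose and $\|\cdot\|$ the Euclidean norm. For a full-rank $\mathbf{V}\in\mathbb{C}^{N\times D}$, $\mathcal{S}(\mathbf{V})\subseteq\mathcal{A}_M^N$ is a candidate set containing a maximizer of $\|\mathbf{V}^{\mathcal{H}}\mathbf{s}\|$ over $\mathcal{A}_M^N$, whose cardinality is given by the formula $|\mathcal{S}(\mathbf{V})|=\sum_{d=1}^{D}\sum_{i=0}^{d-1}\binom{N}{i}\binom{N-i}{2(d-i)-1}(\frac{M}{2})^{2(d-i)-2}(\frac{M}{2}-1)^{i}$; here $|\mathcal{S}(\mathbf{V})|$ denotes the value of this formula at $D=N$. Conventions: $0^0=1$, $\binom{n}{k}=0$ for $k>n$. Sequences that differ by a common phase factor in $\mathcal{A}_M$ give the same value of the objective, and the first element of the sequence is normalized to $1$. *)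

theory Defs
  imports
    "HOL-Analysis.L2_Norm"
    "Jordan_Normal_Form.DL_Rank"
    "Jordan_Normal_Form.Schur_Decomposition"
begin

definition psk :: "nat \<Rightarrow> complex set" where
  "psk M = (\<lambda>m. cis (2 * pi * real m / real M)) ` {0..<M}"

definition psk_seqs :: "nat \<Rightarrow> nat \<Rightarrow> complex vec set" where
  "psk_seqs M n = {s \<in> carrier_vec n. \<forall>i<n. s $ i \<in> psk M}"

definition eucl_norm :: "complex vec \<Rightarrow> real" where
  "eucl_norm v = L2_set (\<lambda>i. cmod (v $ i)) {0..<dim_vec v}"

definition objective :: "complex mat \<Rightarrow> complex vec \<Rightarrow> real" where
  "objective V s = eucl_norm (mat_adjoint V *\<^sub>v s)"

(* The cardinality formula for the candidate set S(V) of an N x D matrix V of full rank D.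
   It is real-valued because M / 2 is; the natural-number subtractions never truncate, since
   i < d, except N - i, where i > N makes the factor "N choose i" vanish anyway. *)
definition candidate_count :: "nat \<Rightarrow> nat \<Rightarrow> nat \<Rightarrow> real" where
  "candidate_count M N D =
    (\<Sum>d = 1..D. \<Sum>i = 0..d - 1.
       real (N choose i) * real ((N - i) choose (2 * (d - i) - 1))
       * (real M / 2) ^ (2 * (d - i) - 2) * (real M / 2 - 1) ^ i)"

end

theory Submission
  imports Defs
begin

text \<open>
  Put \<open>a = M / 2\<close>. Multiplied by \<open>a\<close>, the cardinality formula becomes the part of the multinomial
  expansion of \<open>((a - 1) + 1 + a) ^ N\<close> in which \<open>a\<close> has an odd exponent, so it is half the
  difference of \<open>((a - 1) + 1 + a) ^ N = M ^ N\<close> and \<open>((a - 1) + 1 - a) ^ N = 0\<close>.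
  The search statement holds because \<open>psk M\<close> is the group of \<open>M\<close>-th roots of unity: dividing a
  sequence by its first entry stays in the alphabet and does not change the objective.
\<close>

text \<open>In the difference of the binomial expansions of \<open>(1 + x) ^ n\<close> and
  \<open>(1 - x) ^ n\<close> the even powers cancel and the odd ones double.\<close>

lemma sum_odd_binomial:
  fixes x :: "'a :: field_char_0"
  shows "(\<Sum>k = 1..n. of_nat (n choose (2 * k - 1)) * x ^ (2 * k - 1)) = ((1 + x) ^ n - (1 - x) ^ n) / 2"
proof -
  let ?f = "\<lambda>j. of_nat (n choose j) * x ^ j :: 'a"
  have "(1 + x) ^ n - (1 - x) ^ n = (\<Sum>j\<le>n. ?f j - of_nat (n choose j) * (- x) ^ j)"
    using binomial_ring[of x 1 n] binomial_ring[of "- x" 1 n]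
    by (simp add: sum_subtractf add.commute)
  also have "\<dots> = (\<Sum>j\<le>n. if odd j then 2 * ?f j else 0)"
    by (intro sum.cong) auto
  also have "\<dots> = (\<Sum>j \<in> {j. j \<le> n \<and> odd j}. 2 * ?f j)"
    by (simp add: sum.If_cases Int_def)
  \<comment> \<open>The image also contains odd numbers above \<open>n\<close>; there the binomial
    coefficient is 0, so the simple range \<open>{1..n}\<close> for \<open>k\<close> does no
    harm.\<close>
  also have "\<dots> = (\<Sum>j \<in> (\<lambda>k. 2 * k - 1) ` {1..n}. 2 * ?f j)"
  proof (rule sum.mono_neutral_left)
    show "{j. j \<le> n \<and> odd j} \<subseteq> (\<lambda>k. 2 * k - 1) ` {1..n}"
    proof
      fix j assume "j \<in> {j. j \<le> n \<and> odd j}"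
      then have "j = 2 * ((j + 1) div 2) - 1" "(j + 1) div 2 \<in> {1..n}"
        by (auto elim!: oddE)
      then show "j \<in> (\<lambda>k. 2 * k - 1) ` {1..n}" by blast
    qed
  qed auto
  also have "\<dots> = 2 * (\<Sum>k = 1..n. ?f (2 * k - 1))"
    by (subst sum.reindex) (auto simp: inj_on_def sum_distrib_left)
  finally show ?thesis by simp
qed

lemma candidate_count_square:
  assumes "M > 0" and "N > 0"
  shows "candidate_count M N N = real (M ^ (N - 1))"
proof -
  define a where "a = real M / 2"
  define g where "g i k = real (N choose i) * (a - 1) ^ i *
      (real ((N - i) choose (2 * k - 1)) * a ^ (2 * k - 1))" for i k
  have a: "a > 0" using assms by (simp add: a_def)
  have "a * candidate_count M N N = (\<Sum>d = 1..N. \<Sum>i = 0..d - 1. g i (d - i))"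
    unfolding candidate_count_def sum_distrib_left a_def[symmetric]
  proof (intro sum.cong refl)
    fix d i assume "d \<in> {1..N}" "i \<in> {0..d - 1}"
    \<comment> \<open>Here \<open>i < d\<close>, so the subtractions do not truncate. The extra
      factor \<open>a\<close> raises the exponent to the lower index of the second binomial
      coefficient.\<close>
    then have "2 * (d - i) - 1 = Suc (2 * (d - i) - 2)" by auto
    then have "a ^ (2 * (d - i) - 1) = a * a ^ (2 * (d - i) - 2)" by simp
    then show "a * (real (N choose i) * real ((N - i) choose (2 * (d - i) - 1))
        * a ^ (2 * (d - i) - 2) * (a - 1) ^ i) = g i (d - i)"
      by (simp add: g_def)
  qed
  also have "\<dots> = (\<Sum>(d, i) \<in> (SIGMA d:{1..N}. {0..d - 1}). g i (d - i))"
    by (simp add: sum.Sigma)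
  \<comment> \<open>Substituting \<open>k = d - i\<close> decouples the exponents: \<open>i\<close>
    now counts the factors \<open>a - 1\<close>, and \<open>2 * k - 1\<close> the factors
    \<open>a\<close>. The new index \<open>i = N\<close> has an empty inner range.\<close>
  also have "\<dots> = (\<Sum>(i, k) \<in> (SIGMA i:{..N}. {1..N - i}). g i k)"
    by (rule sum.reindex_bij_witness[of _ "\<lambda>(i, k). (i + k, i)" "\<lambda>(d, i). (i, d - i)"]) auto
  also have "\<dots> = (\<Sum>i\<le>N. \<Sum>k = 1..N - i. g i k)"
    by (simp add: sum.Sigma)
  also have "\<dots> = (\<Sum>i\<le>N. real (N choose i) * (a - 1) ^ i * (((1 + a) ^ (N - i) - (1 - a) ^ (N - i)) / 2))"
    unfolding g_def sum_distrib_left[symmetric] sum_odd_binomial by (rule refl)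
  \<comment> \<open>The binomial theorem read backwards, once for each of the two powers in the
    inner difference.\<close>
  also have "\<dots> = ((a - 1 + (1 + a)) ^ N - (a - 1 + (1 - a)) ^ N) / 2"
    unfolding binomial_ring
    by (simp add: sum_subtractf sum_divide_distrib[symmetric] algebra_simps)
  \<comment> \<open>The second base is 0, and its power vanishes because
    \<open>N > 0\<close>.\<close>
  also have "\<dots> = a * (2 * a) ^ (N - 1)"
    using assms by (cases N) simp_all
  finally show ?thesis using a by (simp add: a_def)
qed

lemma finite_psk: "finite (psk M)"
  by (simp add: psk_def)

text \<open>Turns membership into an equation, from which closure under quotients and the
  cardinality are immediate.\<close>

lemma psk_eq_roots_unity: "M > 0 \<Longrightarrow> psk M = {z. z ^ M = 1}"
  using bij_betw_roots_unity[of M] by (simp add: psk_def bij_betw_def atLeast0LessThan)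

lemma card_psk: "M > 0 \<Longrightarrow> card (psk M) = M"
  by (simp add: psk_eq_roots_unity card_roots_unity_eq)

text \<open>Moves to lists, where finiteness and the count of words of fixed length over a finite
  alphabet are known.\<close>

lemma psk_seqs_eq_image:
  "psk_seqs M n = vec_of_list ` {xs. set xs \<subseteq> psk M \<and> length xs = n}"
proof (intro equalityI subsetI)
  fix s assume s: "s \<in> psk_seqs M n"
  have "set (list_of_vec s) \<subseteq> psk M \<and> length (list_of_vec s) = n"
    using s unfolding psk_seqs_def carrier_vec_def set_list_of_vec vec_set_def by auto
  then show "s \<in> vec_of_list ` {xs. set xs \<subseteq> psk M \<and> length xs = n}"
    by (intro image_eqI[of _ _ "list_of_vec s"]) (simp_all add: vec_list)
next
  fix s assume "s \<in> vec_of_list ` {xs. set xs \<subseteq> psk M \<and> length xs = n}"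
  then obtain xs where s: "s = vec_of_list xs" and xs: "set xs \<subseteq> psk M" "length xs = n" by blast
  have "s \<in> carrier_vec n"
    unfolding s by (rule carrier_vecI) (simp only: dim_vec_of_list xs(2))
  moreover have "s $ i \<in> psk M" if "i < n" for i
    unfolding s vec_of_list_index using xs that nth_mem by blast
  ultimately show "s \<in> psk_seqs M n"
    unfolding psk_seqs_def by blast
qed

lemma finite_psk_seqs: "finite (psk_seqs M n)"
  by (simp add: psk_seqs_eq_image finite_lists_length_eq finite_psk)

lemma card_psk_seqs:
  assumes "M > 0"
  shows "card (psk_seqs M n) = M ^ n"
proof -
  have "inj_on vec_of_list {xs. set xs \<subseteq> psk M \<and> length xs = n}"
    by (rule inj_on_inverseI[of _ list_of_vec]) (simp add: list_vec)
  then show ?thesis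
    using finite_psk by (simp add: psk_seqs_eq_image card_image card_lists_length_eq card_psk assms)
qed

lemma eucl_norm_smult: "eucl_norm (c \<cdot>\<^sub>v v) = cmod c * eucl_norm v"
proof -
  have "eucl_norm (c \<cdot>\<^sub>v v) = L2_set (\<lambda>i. cmod c * cmod (v $ i)) {0..<dim_vec v}"
    unfolding eucl_norm_def by (rule L2_set_cong) (auto simp: norm_mult)
  then show ?thesis by (simp add: eucl_norm_def L2_set_right_distrib)
qed

lemma objective_smult:
  assumes "V \<in> carrier_mat N D" "s \<in> carrier_vec N" "cmod c = 1"
  shows "objective V (c \<cdot>\<^sub>v s) = objective V s"
proof -
  have "mat_adjoint V \<in> carrier_mat D N"
    using assms(1) by (auto simp: mat_adjoint_def)
  then have "mat_adjoint V *\<^sub>v (c \<cdot>\<^sub>v s) = c \<cdot>\<^sub>v (mat_adjoint V *\<^sub>v s)"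
    using assms(2) by (rule mult_mat_vec)
  then show ?thesis by (simp add: objective_def eucl_norm_smult assms(3))
qed

lemma vCons_one_psk_seqs:
  assumes "M > 0" "t \<in> psk_seqs M n"
  shows "vCons 1 t \<in> psk_seqs M (Suc n)"
  using assms by (auto simp: psk_seqs_def psk_eq_roots_unity less_Suc_eq_0_disj)

text \<open>Quotients of roots of unity are roots of unity, so \<open>c\<close> can be the first
  entry of \<open>s\<close> and \<open>t\<close> the remaining entries divided by it.\<close>

lemma psk_seqs_normalize:
  assumes "M > 0" "s \<in> psk_seqs M (Suc n)"
  obtains c t where "cmod c = 1" "t \<in> psk_seqs M n" "s = c \<cdot>\<^sub>v vCons 1 t"
proof -
  have s: "dim_vec s = Suc n" "\<And>i. i < Suc n \<Longrightarrow> (s $ i) ^ M = 1"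
    using assms by (auto simp: psk_seqs_def psk_eq_roots_unity)
  define t where "t = vec n (\<lambda>i. s $ Suc i / s $ 0)"
  have s0: "s $ 0 \<noteq> 0" using s(2)[of 0] assms(1) by (auto simp: power_0_left)
  have "cmod (s $ 0) ^ M = 1" using s(2)[of 0] by (simp add: norm_power[symmetric])
  then have "cmod (s $ 0) = 1" using assms(1) power_eq_imp_eq_base[of "cmod (s $ 0)" M 1] by simp
  moreover have "t \<in> psk_seqs M n"
    using s assms(1) by (auto simp: t_def psk_seqs_def psk_eq_roots_unity power_divide)
  moreover have "s = s $ 0 \<cdot>\<^sub>v vCons 1 t"
    using s s0 by (intro eq_vecI) (auto simp: t_def less_Suc_eq_0_disj)
  ultimately show ?thesis by (rule that)
qed

text \<open>Equality of the whole value sets yields both the equality of the maxima and the transfer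
  of maximizers.\<close>

lemma objective_image_normalized:
  assumes "M > 0" "V \<in> carrier_mat (Suc n) D"
  shows "objective V ` psk_seqs M (Suc n) = (\<lambda>t. objective V (vCons 1 t)) ` psk_seqs M n"
proof (intro equalityI image_subsetI)
  fix s assume "s \<in> psk_seqs M (Suc n)"
  then obtain c t where c: "cmod c = 1" and t: "t \<in> psk_seqs M n" and s: "s = c \<cdot>\<^sub>v vCons 1 t"
    using psk_seqs_normalize assms(1) by blast
  have "vCons 1 t \<in> carrier_vec (Suc n)"
    using vCons_one_psk_seqs[OF assms(1) t] by (simp add: psk_seqs_def)
  then have "objective V s = objective V (vCons 1 t)"
    using objective_smult[OF assms(2)] c by (simp add: s)
  then show "objective V s \<in> (\<lambda>t. objective V (vCons 1 t)) ` psk_seqs M n" using t by blast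
qed (use vCons_one_psk_seqs[OF assms(1)] in blast)

theorem proposition3:
  fixes M N :: nat and V :: "complex mat"
  assumes "M \<ge> 2" and "even M" and "N \<ge> 1"
    and "V \<in> carrier_mat N N"
    and "vec_space.rank N V = N"
  shows
    "(candidate_count M N N =
           (\<Sum>d = 1..N. \<Sum>i = 0..d - 1.
              real (N choose i) * real ((N - i) choose (2 * (d - i) - 1))
              * (real M / 2) ^ (2 * (d - i) - 2) * (real M / 2 - 1) ^ i)) \<and>
     (candidate_count M N N = real (M ^ (N - 1))) \<and>
     (M ^ (N - 1) = card (psk_seqs M (N - 1))) \<and>
     (Max (objective V ` psk_seqs M N)
         = Max ((\<lambda>t. objective V (vCons 1 t)) ` psk_seqs M (N - 1))) \<and>
     (\<exists>t. is_arg_max (\<lambda>t. objective V (vCons 1 t)) (\<lambda>t. t \<in> psk_seqs M (N - 1)) t) \<and>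
     (\<forall>t. is_arg_max (\<lambda>t. objective V (vCons 1 t)) (\<lambda>t. t \<in> psk_seqs M (N - 1)) t \<longrightarrow>
           is_arg_max (objective V) (\<lambda>s. s \<in> psk_seqs M N) (vCons 1 t))"
proof (intro conjI allI impI)
  have M: "M > 0" using assms by simp
  have image_eq: "objective V ` psk_seqs M N = (\<lambda>t. objective V (vCons 1 t)) ` psk_seqs M (N - 1)"
    using objective_image_normalized[of M V "N - 1" N] assms(3,4) M by simp
  show "candidate_count M N N =
           (\<Sum>d = 1..N. \<Sum>i = 0..d - 1.
              real (N choose i) * real ((N - i) choose (2 * (d - i) - 1))
              * (real M / 2) ^ (2 * (d - i) - 2) * (real M / 2 - 1) ^ i)"
    by (rule candidate_count_def)
  show "candidate_count M N N = real (M ^ (N - 1))"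
    using candidate_count_square M assms(3) by simp
  show "M ^ (N - 1) = card (psk_seqs M (N - 1))"
    by (simp add: card_psk_seqs M)
  show "Max (objective V ` psk_seqs M N)
         = Max ((\<lambda>t. objective V (vCons 1 t)) ` psk_seqs M (N - 1))"
    by (simp only: image_eq)
  have "psk_seqs M (N - 1) \<noteq> {}"
    using card_psk_seqs[OF M, of "N - 1"] M by auto
  \<comment> \<open>A maximizer is a minimizer of the negated objective, which exists on a finite
    nonempty set.\<close>
  then show "\<exists>t. is_arg_max (\<lambda>t. objective V (vCons 1 t)) (\<lambda>t. t \<in> psk_seqs M (N - 1)) t"
    using ex_is_arg_min_if_finite[OF finite_psk_seqs, of M "N - 1" "\<lambda>t. - objective V (vCons 1 t)"]
    unfolding is_arg_min_def is_arg_max_def neg_less_iff_less by blast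
  fix t assume t: "is_arg_max (\<lambda>t. objective V (vCons 1 t)) (\<lambda>t. t \<in> psk_seqs M (N - 1)) t"
  then have "vCons 1 t \<in> psk_seqs M N"
    using vCons_one_psk_seqs[OF M, of t "N - 1"] assms(3) by (simp add: is_arg_max_def)
  moreover have "objective V s \<le> objective V (vCons 1 t)" if "s \<in> psk_seqs M N" for s
  proof -
    \<comment> \<open>The value at \<open>s\<close> is also attained at a normalized sequence, to
      which the maximality of \<open>t\<close> applies.\<close>
    have "objective V s \<in> (\<lambda>t. objective V (vCons 1 t)) ` psk_seqs M (N - 1)"
      using that image_eq by blast
    then show ?thesis using t by (auto simp: is_arg_max_linorder)
  qed
  ultimately show "is_arg_max (objective V) (\<lambda>s. s \<in> psk_seqs M N) (vCons 1 t)"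
    by (simp add: is_arg_max_linorder)
qed

end
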